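(* Let $t>0$, let $i_1<\dots<i_M$ be real, let $\underline p\in\mathbb S^M$, let $\underline b=(b_2,\dots,b_{M-1})$ satisfy $-\frac{1}{i_{j+1}-i_j}<b_j<\frac{1}{i_j-i_{j-1}}$ for $j=2,\dots,M-1$, and let $\underline k=(k_2,\dots,k_{M-1})\in\mathbb R_+^{M-2}$. There exist a unique $\alpha\in(0,1]$, $l\in\{2,\dots,M\}$, $x_0\in(\kappa_{l-1},\kappa_l]$ and $\underline\lambda=(\lambda_2,\dots,\lambda_{M-1})\in\mathbb R_+^{M-2}$ satisfying, for $j=1,\dots,M+1$, $$\big(\widehat{\underline p}\,\widetilde{\mathcal N}_t\big)_j=\begin{cases}\frac{x_0-\kappa_{l-1}}{\kappa_l-\kappa_{l-1}}&j=l\\[2pt]\frac{\kappa_l-x_0}{\kappa_l-\kappa_{l-1}}&j=l-1\\[2pt]0&\text{otherwise,}\end{cases}$$ where $\widehat{\underline p}$ is the row vector with $\widehat p_j=\alpha p_j$ for $j=1,\dots,M$ and $\widehat p_{M+1}=1-\alpha$. The solution is (with $\lambda_1=\lambda_M=0$) $$\lambda_j=\mathcal G_j(t,\underline p)\ (2\le j\le M-1),\qquad \alpha=\frac{1}{1+t\sum_{j=1}^Mp_j\lambda_j\widetilde k_j},\qquad x_0=\frac{\sum_{j=1}^M\kappa_jp_j(1+t\,\mathcal G_j(t,\underline p)\widetilde k_j)}{\sum_{j=1}^Mp_j(1+t\,\mathcal G_j(t,\underline p)\widetilde k_j)}.$$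
   Context: Conventions: $\mathbb R_+=[0,\infty)$, $M\ge3$, $\mathbb S^M=\{(p_1,\dots,p_M):0<p_j<1,\ \sum_jp_j=1\}$. Set $\widetilde k_j=(i_{j+1}-i_j)(i_j-i_{j-1})k_j$ for $2\le j\le M-1$, $\widetilde k_1=\widetilde k_M=0$; for $2\le j\le M-1$, $q_{j,j+1}=\frac{i_j-i_{j-1}}{i_{j+1}-i_{j-1}}(1+(i_{j+1}-i_j)b_j)$, $q_{j,j-1}=\frac{i_{j+1}-i_j}{i_{j+1}-i_{j-1}}(1-(i_j-i_{j-1})b_j)$. $\widetilde{\mathcal N}_t=\widetilde{\mathcal N}_t(\underline k,\underline\lambda)$ is the $(M+1)\times(M+1)$ matrix whose rows $1$, $M$, $M+1$ are those of the identity matrix and, for $2\le j\le M-1$, $\widetilde{\mathcal N}_{t;j,j}=1+t\lambda_j(1+\widetilde k_j)$, $\widetilde{\mathcal N}_{t;j,j+1}=-t\lambda_jq_{j,j+1}$, $\widetilde{\mathcal N}_{t;j,j-1}=-t\lambda_jq_{j,j-1}$ (neighbours in $\{1,\dots,M\}$), $\widetilde{\mathcal N}_{t;j,M+1}=-t\lambda_j\widetilde k_j$, all other entries $0$. Coordinate change $\underline\kappa=(\kappa_1,\dots,\kappa_M)$: let $\delta_j=i_j-i_{j-1}$ ($2\le j\le M$); $\Pi_1=1$, $\Pi_j=\prod_{n=2}^j\frac{1-\delta_nb_n}{1+\delta_{n+1}b_n}$ ($2\le j\le M-1$). Fix $\vartheta\in(0,\frac12)$ with $e_-:=\inf\{j:\sum_{i=1}^jp_i\ge\vartheta\}<e_+:=\sup\{j:\sum_{i=j}^Mp_i\ge\vartheta\}$,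 let $K=(i_{e_+}-i_{e_-})\vee1$, $\epsilon_{j+1}=K\,\delta_{j+1}\Pi_j\big/\sum_{a=e_-}^{e_+-1}\delta_{a+1}\Pi_a$ ($1\le j\le M-1$). Let $e$ satisfy $\sum_{i\le e}p_i\ge\frac12$, $\sum_{i\ge e}p_i\ge\frac12$. Then $\kappa_e=0$ and $\kappa_j-\kappa_{j-1}=\epsilon_j$ for $2\le j\le M$; $\underline\kappa$ is strictly increasing and $q_{j,j+1}=\frac{\kappa_j-\kappa_{j-1}}{\kappa_{j+1}-\kappa_{j-1}}$, $q_{j,j-1}=\frac{\kappa_{j+1}-\kappa_j}{\kappa_{j+1}-\kappa_{j-1}}$. $\mathcal G(t,\underline p)=(\mathcal G_1,\dots,\mathcal G_M)$ (nonnegative entries) is defined by the system: $\mathcal G_1=\mathcal G_M=0$, $$\mathcal G_j=\frac{1}{tp_j}\frac{\kappa_{j+1}-\kappa_{j-1}}{(\kappa_{j+1}-\kappa_j)(\kappa_j-\kappa_{j-1})}\times\begin{cases}\sum_{a=1}^{j-1}(\kappa_j-\kappa_a)p_a(1+t\mathcal G_a\widetilde k_a)&2\le j\le l-1\\ \sum_{a=j+1}^{M}(\kappa_a-\kappa_j)p_a(1+t\mathcal G_a\widetilde k_a)&l\le j\le M-1\end{cases}$$ where $l$ is the index with $\kappa_{l-1}<\frac{\sum_{j=1}^M\kappa_jp_j(1+t\mathcal G_j\widetilde k_j)}{\sum_{j=1}^Mp_j(1+t\mathcal G_j\widetilde k_j)}\le\kappa_l$. *)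

theory Defs
  imports Complex_Main
begin

text \<open>
  Vectors and matrices are functions on \<open>nat\<close> with 1-based indices: \<open>i\<close> and \<open>p\<close> are only read on
  \<open>{1..M}\<close>, \<open>b\<close> and \<open>k\<close> on \<open>{2..M - 1}\<close>. The unknown vectors \<open>lam\<close> (for \<open>\<lambda>\<close>) and \<open>g\<close>, \<open>calG\<close> (for \<open>\<G>\<close>)
  are normalised to be 0 off \<open>{2..M - 1}\<close>, so that uniqueness of the function is uniqueness of
  the vector.
\<close>

definition open_simplex :: "nat \<Rightarrow> (nat \<Rightarrow> real) set" where
  "open_simplex M = {p. (\<forall>j\<in>{1..M}. 0 < p j \<and> p j < 1) \<and> (\<Sum>j=1..M. p j) = 1}"

text \<open>The orthant with coordinates \<open>2, \<dots>, M - 1\<close>; the normalisation contains the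
  conventions \<open>\<lambda>\<^sub>1 = \<lambda>\<^sub>M = 0\<close> and \<open>\<G>\<^sub>1 = \<G>\<^sub>M = 0\<close>.\<close>
definition nonneg_interior :: "nat \<Rightarrow> (nat \<Rightarrow> real) set" where
  "nonneg_interior M =
     {v. (\<forall>j\<in>{2..M-1}. 0 \<le> v j) \<and> (\<forall>j. j \<notin> {2..M-1} \<longrightarrow> v j = 0)}"

definition k_tilde :: "nat \<Rightarrow> (nat \<Rightarrow> real) \<Rightarrow> (nat \<Rightarrow> real) \<Rightarrow> nat \<Rightarrow> real" where
  "k_tilde M i k j =
     (if j \<in> {2..M-1} then (i (j+1) - i j) * (i j - i (j-1)) * k j else 0)"

definition q_up :: "(nat \<Rightarrow> real) \<Rightarrow> (nat \<Rightarrow> real) \<Rightarrow> nat \<Rightarrow> real" where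
  "q_up i b j = (i j - i (j-1)) / (i (j+1) - i (j-1)) * (1 + (i (j+1) - i j) * b j)"

definition q_down :: "(nat \<Rightarrow> real) \<Rightarrow> (nat \<Rightarrow> real) \<Rightarrow> nat \<Rightarrow> real" where
  "q_down i b j = (i (j+1) - i j) / (i (j+1) - i (j-1)) * (1 - (i j - i (j-1)) * b j)"

definition N_tilde ::
  "nat \<Rightarrow> (nat \<Rightarrow> real) \<Rightarrow> (nat \<Rightarrow> real) \<Rightarrow> (nat \<Rightarrow> real) \<Rightarrow> real \<Rightarrow> (nat \<Rightarrow> real)
     \<Rightarrow> nat \<Rightarrow> nat \<Rightarrow> real" where
  "N_tilde M i b k t lam r c =
     (if r \<in> {2..M-1} then
        (if c = r then 1 + t * lam r * (1 + k_tilde M i k r)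
         else if c = r + 1 then - t * lam r * q_up i b r
         else if c = r - 1 then - t * lam r * q_down i b r
         else if c = M + 1 then - t * lam r * k_tilde M i k r
         else 0)
      else if c = r then 1 else 0)"

definition p_hat :: "nat \<Rightarrow> (nat \<Rightarrow> real) \<Rightarrow> real \<Rightarrow> nat \<Rightarrow> real" where
  "p_hat M p \<alpha> j = (if j = M + 1 then 1 - \<alpha> else \<alpha> * p j)"

definition row_times_matrix ::
  "nat \<Rightarrow> (nat \<Rightarrow> real) \<Rightarrow> (nat \<Rightarrow> nat \<Rightarrow> real) \<Rightarrow> nat \<Rightarrow> real" where
  "row_times_matrix n v A c = (\<Sum>r=1..n. v r * A r c)"

definition gap :: "(nat \<Rightarrow> real) \<Rightarrow> nat \<Rightarrow> real" where
  "gap i j = i j - i (j-1)"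

definition Pi_coeff :: "(nat \<Rightarrow> real) \<Rightarrow> (nat \<Rightarrow> real) \<Rightarrow> nat \<Rightarrow> real" where
  "Pi_coeff i b j = (\<Prod>n=2..j. (1 - gap i n * b n) / (1 + gap i (n+1) * b n))"

definition e_minus :: "nat \<Rightarrow> (nat \<Rightarrow> real) \<Rightarrow> real \<Rightarrow> nat" where
  "e_minus M p \<theta> = Inf {j\<in>{1..M}. \<theta> \<le> (\<Sum>n=1..j. p n)}"

definition e_plus :: "nat \<Rightarrow> (nat \<Rightarrow> real) \<Rightarrow> real \<Rightarrow> nat" where
  "e_plus M p \<theta> = Sup {j\<in>{1..M}. \<theta> \<le> (\<Sum>n=j..M. p n)}"

definition eps ::
  "nat \<Rightarrow> (nat \<Rightarrow> real) \<Rightarrow> (nat \<Rightarrow> real) \<Rightarrow> (nat \<Rightarrow> real) \<Rightarrow> real \<Rightarrow> nat \<Rightarrow> real" where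
  "eps M i b p \<theta> j =
     max (i (e_plus M p \<theta>) - i (e_minus M p \<theta>)) 1 * gap i j * Pi_coeff i b (j-1)
       / (\<Sum>a=e_minus M p \<theta>..<e_plus M p \<theta>. gap i (a+1) * Pi_coeff i b a)"

definition kappa ::
  "nat \<Rightarrow> (nat \<Rightarrow> real) \<Rightarrow> (nat \<Rightarrow> real) \<Rightarrow> (nat \<Rightarrow> real) \<Rightarrow> real \<Rightarrow> nat \<Rightarrow> nat \<Rightarrow> real" where
  "kappa M i b p \<theta> e j =
     (if e \<le> j then (\<Sum>n=e+1..j. eps M i b p \<theta> n) else - (\<Sum>n=j+1..e. eps M i b p \<theta> n))"

lemma kappa_base: "kappa M i b p \<theta> e e = 0"
  by (simp add: kappa_def)

lemma kappa_step:
  assumes "2 \<le> j"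
  shows "kappa M i b p \<theta> e j - kappa M i b p \<theta> e (j-1) = eps M i b p \<theta> j"
proof (cases "e < j")
  case True
  then obtain m where m: "j = Suc m" "e \<le> m" by (cases j) auto
  then show ?thesis by (simp add: kappa_def)
next
  case False
  then obtain m where m: "j = Suc m" "m < e" using assms by (cases j) auto
  then show ?thesis
    by (auto simp: kappa_def sum.atLeast_Suc_atMost[of "Suc m" e])
qed

text \<open>Below, \<open>\<kappa>\<close> stands for \<open>kappa M i b p \<theta> e\<close> and \<open>kt\<close> for \<open>k_tilde M i k\<close>.\<close>

definition weighted_mean ::
  "nat \<Rightarrow> (nat \<Rightarrow> real) \<Rightarrow> (nat \<Rightarrow> real) \<Rightarrow> real \<Rightarrow> (nat \<Rightarrow> real) \<Rightarrow> (nat \<Rightarrow> real) \<Rightarrow> real" where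
  "weighted_mean M \<kappa> kt t p g =
     (\<Sum>j=1..M. \<kappa> j * p j * (1 + t * g j * kt j)) / (\<Sum>j=1..M. p j * (1 + t * g j * kt j))"

definition G_system ::
  "nat \<Rightarrow> (nat \<Rightarrow> real) \<Rightarrow> (nat \<Rightarrow> real) \<Rightarrow> real \<Rightarrow> (nat \<Rightarrow> real) \<Rightarrow> (nat \<Rightarrow> real) \<Rightarrow> bool" where
  "G_system M \<kappa> kt t p g \<longleftrightarrow>
     g \<in> nonneg_interior M \<and>
     (\<exists>l\<in>{2..M}.
        \<kappa> (l-1) < weighted_mean M \<kappa> kt t p g \<and> weighted_mean M \<kappa> kt t p g \<le> \<kappa> l \<and>
        (\<forall>j\<in>{2..M-1}.
           g j = 1 / (t * p j) * ((\<kappa> (j+1) - \<kappa> (j-1)) / ((\<kappa> (j+1) - \<kappa> j) * (\<kappa> j - \<kappa> (j-1)))) *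
             (if j \<le> l - 1 then (\<Sum>a=1..j-1. (\<kappa> j - \<kappa> a) * p a * (1 + t * g a * kt a))
              else (\<Sum>a=j+1..M. (\<kappa> a - \<kappa> j) * p a * (1 + t * g a * kt a)))))"

text \<open>Meaningful only where \<open>G_system\<close> has exactly one solution.\<close>
definition calG ::
  "nat \<Rightarrow> (nat \<Rightarrow> real) \<Rightarrow> (nat \<Rightarrow> real) \<Rightarrow> real \<Rightarrow> (nat \<Rightarrow> real) \<Rightarrow> nat \<Rightarrow> real" where
  "calG M \<kappa> kt t p = (THE g. G_system M \<kappa> kt t p g)"

definition is_solution ::
  "nat \<Rightarrow> (nat \<Rightarrow> real) \<Rightarrow> (nat \<Rightarrow> real) \<Rightarrow> (nat \<Rightarrow> real) \<Rightarrow> (nat \<Rightarrow> real) \<Rightarrow> real \<Rightarrow> (nat \<Rightarrow> real)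
     \<Rightarrow> real \<Rightarrow> nat \<Rightarrow> real \<Rightarrow> (nat \<Rightarrow> real) \<Rightarrow> bool" where
  "is_solution M \<kappa> i b k t p \<alpha> l x0 lam \<longleftrightarrow>
     0 < \<alpha> \<and> \<alpha> \<le> 1 \<and> l \<in> {2..M} \<and> \<kappa> (l-1) < x0 \<and> x0 \<le> \<kappa> l \<and> lam \<in> nonneg_interior M \<and>
     (\<forall>j\<in>{1..M+1}.
        row_times_matrix (M+1) (p_hat M p \<alpha>) (N_tilde M i b k t lam) j =
          (if j = l then (x0 - \<kappa> (l-1)) / (\<kappa> l - \<kappa> (l-1))
           else if j = l - 1 then (\<kappa> l - x0) / (\<kappa> l - \<kappa> (l-1))
           else 0))"

end

theory Submission
  imports Defs
begin

text \<open>
  Write \<open>m a = p a * (1 + t * g a * kt a)\<close>. The equation for \<open>g j\<close> with \<open>j < l\<close> only involves \<open>m a\<close>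
  with \<open>a < j\<close>, the one with \<open>j \<ge> l\<close> only \<open>m a\<close> with \<open>a > j\<close>. So \<open>m\<close> is obtained by gluing, at \<open>l\<close>,
  a forward and a backward recursion neither of which depends on \<open>l\<close>, and the bracketing of
  the mean says that \<open>l\<close> is the first index at which the put function of the forward solution
  reaches the call function of the backward one. The first is increasing and starts at \<open>0\<close>, the second
  is decreasing and ends at \<open>0\<close>, so \<open>l\<close> exists and is unique.

  The column equations say that \<open>\<alpha> * m\<close> plus a discrete second difference in \<open>\<kappa>\<close> of a potential,
  which vanishes at both ends, is a two-point mass with mean \<open>x0\<close>. Tested against constants they
  fix \<open>\<alpha>\<close>, against the identity \<open>x0\<close>, and against put payoffs the potential: it is the put function
  of \<open>m\<close> to the left of \<open>x0\<close> and, by put-call parity, the call function to the right.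
\<close>

locale increasing_grid =
  fixes M :: nat and \<kappa> kt p :: "nat \<Rightarrow> real" and t :: real
  assumes M_ge: "2 \<le> M" and t_pos: "0 < t"
    and \<kappa>_less: "\<And>m n. 1 \<le> m \<Longrightarrow> m < n \<Longrightarrow> n \<le> M \<Longrightarrow> \<kappa> m < \<kappa> n"
    and p_pos: "\<And>j. j \<in> {1..M} \<Longrightarrow> 0 < p j"
    and kt_nonneg: "\<And>j. 0 \<le> kt j"
    and kt_outside: "\<And>j. j \<notin> {2..M-1} \<Longrightarrow> kt j = 0"
begin

lemma \<kappa>_le: "1 \<le> m \<Longrightarrow> m \<le> n \<Longrightarrow> n \<le> M \<Longrightarrow> \<kappa> m \<le> \<kappa> n"
  using \<kappa>_less[of m n] by (cases "m = n") auto

lemma t_p_pos: "j \<in> {2..M-1} \<Longrightarrow> 0 < t * p j"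
  using p_pos[of j] t_pos by auto

definition rate :: "nat \<Rightarrow> real" where
  "rate j = (\<kappa> (j+1) - \<kappa> (j-1)) / ((\<kappa> (j+1) - \<kappa> j) * (\<kappa> j - \<kappa> (j-1)))"

lemma rate_pos:
  assumes "j \<in> {2..M-1}" shows "0 < rate j"
  using assms \<kappa>_less[of "j-1" j] \<kappa>_less[of j "j+1"] \<kappa>_less[of "j-1" "j+1"]
  unfolding rate_def by (intro divide_pos_pos mult_pos_pos) auto

definition mass :: "(nat \<Rightarrow> real) \<Rightarrow> nat \<Rightarrow> real" where
  "mass g j = p j * (1 + t * g j * kt j)"

definition put :: "(nat \<Rightarrow> real) \<Rightarrow> nat \<Rightarrow> real" where
  "put m j = (\<Sum>a=1..j-1. (\<kappa> j - \<kappa> a) * m a)"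

definition call :: "(nat \<Rightarrow> real) \<Rightarrow> nat \<Rightarrow> real" where
  "call m j = (\<Sum>a=j+1..M. (\<kappa> a - \<kappa> j) * m a)"

lemma put_def': "put m j = (\<Sum>a=1..j. (\<kappa> j - \<kappa> a) * m a)"
  by (cases j) (auto simp: put_def)

lemma put_cong: "(\<And>a. a \<in> {1..j-1} \<Longrightarrow> m a = m' a) \<Longrightarrow> put m j = put m' j"
  unfolding put_def by (intro sum.cong) auto

lemma call_cong: "(\<And>a. a \<in> {j+1..M} \<Longrightarrow> m a = m' a) \<Longrightarrow> call m j = call m' j"
  unfolding call_def by (intro sum.cong) auto

lemma call_minus_put:
  assumes "j \<in> {1..M}"
  shows "call m j - put m j = (\<Sum>a=1..M. (\<kappa> a - \<kappa> j) * m a)"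
proof -
  have "{1..M} = {1..j-1} \<union> {j} \<union> {j+1..M}" using assms by auto
  then have "(\<Sum>a=1..M. (\<kappa> a - \<kappa> j) * m a)
      = (\<Sum>a\<in>{1..j-1} \<union> {j}. (\<kappa> a - \<kappa> j) * m a) + (\<Sum>a=j+1..M. (\<kappa> a - \<kappa> j) * m a)"
    by (simp only:) (rule sum.union_disjoint, auto)
  also have "(\<Sum>a\<in>{1..j-1} \<union> {j}. (\<kappa> a - \<kappa> j) * m a) = (\<Sum>a=1..j-1. (\<kappa> a - \<kappa> j) * m a)"
    by (subst sum.union_disjoint) (use assms in auto)
  also have "\<dots> = - put m j"
    unfolding put_def sum_negf[symmetric] by (intro sum.cong) (auto simp: algebra_simps)
  finally show ?thesis by (simp add: call_def)
qed

function left_mass :: "nat \<Rightarrow> real" where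
  "left_mass j = p j + kt j * rate j * (\<Sum>a=1..j-1. (\<kappa> j - \<kappa> a) * left_mass a)"
  by auto
termination by (relation "measure id") auto

function right_mass :: "nat \<Rightarrow> real" where
  "right_mass j = p j + kt j * rate j * (\<Sum>a=j+1..M. (\<kappa> a - \<kappa> j) * right_mass a)"
  by auto
termination by (relation "measure (\<lambda>j. M - j)") auto

declare left_mass.simps [simp del] right_mass.simps [simp del]

lemma left_mass_eq: "left_mass j = p j + kt j * rate j * put left_mass j"
  by (subst left_mass.simps) (simp add: put_def)

lemma right_mass_eq: "right_mass j = p j + kt j * rate j * call right_mass j"
  by (subst right_mass.simps) (simp add: call_def)

lemma put_nonneg:
  assumes "j \<in> {1..M}" "\<And>a. a \<in> {1..j-1} \<Longrightarrow> 0 \<le> m a"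
  shows "0 \<le> put m j"
  unfolding put_def using assms \<kappa>_le by (intro sum_nonneg mult_nonneg_nonneg) auto

lemma call_nonneg:
  assumes "j \<in> {1..M}" "\<And>a. a \<in> {j+1..M} \<Longrightarrow> 0 \<le> m a"
  shows "0 \<le> call m j"
  unfolding call_def using assms \<kappa>_le by (intro sum_nonneg mult_nonneg_nonneg) auto

lemma put_mono:
  assumes "\<And>a. a \<in> {1..M} \<Longrightarrow> 0 \<le> m a" and "1 \<le> j" "j \<le> j'" "j' \<le> M"
  shows "put m j \<le> put m j'"
proof -
  have "put m j \<le> (\<Sum>a=1..j-1. (\<kappa> j' - \<kappa> a) * m a)"
    unfolding put_def using assms \<kappa>_le[of j j'] by (intro sum_mono mult_right_mono) auto
  also have "\<dots> \<le> put m j'"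
    unfolding put_def using assms \<kappa>_le
    by (intro sum_mono2 mult_nonneg_nonneg) auto
  finally show ?thesis .
qed

lemma call_antimono:
  assumes "\<And>a. a \<in> {1..M} \<Longrightarrow> 0 \<le> m a" and "1 \<le> j" "j \<le> j'" "j' \<le> M"
  shows "call m j' \<le> call m j"
proof -
  have "call m j' \<le> (\<Sum>a=j'+1..M. (\<kappa> a - \<kappa> j) * m a)"
    unfolding call_def using assms \<kappa>_le[of j j'] by (intro sum_mono mult_right_mono) auto
  also have "\<dots> \<le> call m j"
    unfolding call_def using assms \<kappa>_le
    by (intro sum_mono2 mult_nonneg_nonneg) auto
  finally show ?thesis .
qed

lemma kt_rate_nonneg: "0 \<le> kt j * rate j"
  using kt_nonneg[of j] kt_outside[of j] rate_pos[of j] by (cases "j \<in> {2..M-1}") auto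

lemma left_mass_pos: "j \<in> {1..M} \<Longrightarrow> 0 < left_mass j"
proof (induction j rule: less_induct)
  case (less j)
  have "0 \<le> left_mass a" if "a \<in> {1..j-1}" for a
    using less.IH[of a] that less.prems by force
  then have "0 \<le> put left_mass j" by (rule put_nonneg[OF less.prems])
  then show ?case
    using p_pos[OF less.prems] mult_nonneg_nonneg[OF kt_rate_nonneg]
    by (subst left_mass_eq) (rule add_pos_nonneg)
qed

lemma right_mass_pos: "j \<in> {1..M} \<Longrightarrow> 0 < right_mass j"
proof (induction "M - j" arbitrary: j rule: less_induct)
  case less
  have "0 \<le> right_mass a" if "a \<in> {j+1..M}" for a
    using less.hyps[of a] that less.prems by force
  then have "0 \<le> call right_mass j" by (rule call_nonneg[OF less.prems])
  then show ?case
    using p_pos[OF less.prems] mult_nonneg_nonneg[OF kt_rate_nonneg]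
    by (subst right_mass_eq) (rule add_pos_nonneg)
qed

definition crossing :: "nat \<Rightarrow> bool" where
  "crossing l \<longleftrightarrow> l \<in> {2..M} \<and> put left_mass (l-1) < call right_mass (l-1)
     \<and> call right_mass l \<le> put left_mass l"

lemma ex1_crossing: "\<exists>!l. crossing l"
proof (rule ex_ex1I)
  define Q where "Q l \<longleftrightarrow> l \<in> {1..M} \<and> call right_mass l \<le> put left_mass l" for l
  have "0 \<le> put left_mass M"
    using M_ge left_mass_pos by (intro put_nonneg) (auto simp: less_imp_le)
  then have "Q M" using M_ge by (simp add: Q_def call_def)
  then have Q: "Q (Least Q)" by (rule LeastI)
  have "0 < call right_mass 1"
    unfolding call_def using M_ge \<kappa>_less right_mass_pos
    by (intro sum_pos mult_pos_pos) auto
  then have "\<not> Q 1" by (simp add: Q_def put_def)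
  with Q have l: "Least Q \<in> {2..M}" by (cases "Least Q = 1") (auto simp: Q_def)
  have "\<not> Q (Least Q - 1)" using l by (intro not_less_Least) auto
  then show "\<exists>l. crossing l"
    using Q l by (intro exI[of _ "Least Q"]) (auto simp: Q_def crossing_def)
next
  have False if "crossing l" "crossing l'" "l < l'" for l l'
  proof -
    have "put left_mass l \<le> put left_mass (l'-1)"
      using that left_mass_pos by (intro put_mono) (auto simp: crossing_def less_imp_le)
    moreover have "call right_mass (l'-1) \<le> call right_mass l"
      using that right_mass_pos by (intro call_antimono) (auto simp: crossing_def less_imp_le)
    ultimately show False using that by (auto simp: crossing_def)
  qed
  then show "l = l'" if "crossing l" "crossing l'" for l l'
    using that by (meson nat_neq_iff)
qed

definition balance :: "nat \<Rightarrow> (nat \<Rightarrow> real) \<Rightarrow> bool" where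
  "balance l g \<longleftrightarrow> (\<forall>j\<in>{2..M-1}.
     t * p j * g j = rate j * (if j \<le> l - 1 then put (mass g) j else call (mass g) j))"

definition G_system_at :: "nat \<Rightarrow> (nat \<Rightarrow> real) \<Rightarrow> bool" where
  "G_system_at l g \<longleftrightarrow> l \<in> {2..M} \<and> g \<in> nonneg_interior M \<and> balance l g \<and>
     \<kappa> (l-1) < weighted_mean M \<kappa> kt t p g \<and> weighted_mean M \<kappa> kt t p g \<le> \<kappa> l"

lemma G_system_iff: "G_system M \<kappa> kt t p g \<longleftrightarrow> (\<exists>l. G_system_at l g)"
proof -
  have "balance l g \<longleftrightarrow> (\<forall>j\<in>{2..M-1}.
         g j = 1 / (t * p j) * ((\<kappa> (j+1) - \<kappa> (j-1)) / ((\<kappa> (j+1) - \<kappa> j) * (\<kappa> j - \<kappa> (j-1)))) *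
           (if j \<le> l - 1 then (\<Sum>a=1..j-1. (\<kappa> j - \<kappa> a) * p a * (1 + t * g a * kt a))
            else (\<Sum>a=j+1..M. (\<kappa> a - \<kappa> j) * p a * (1 + t * g a * kt a))))" for l
    unfolding balance_def
  proof (intro ball_cong refl)
    fix j assume "j \<in> {2..M-1}"
    then have "t * p j \<noteq> 0" using t_p_pos by fastforce
    then have scale: "t * p j * g j = r * x \<longleftrightarrow> g j = 1 / (t * p j) * r * x" for r x
      using nonzero_eq_divide_eq[of "t * p j" "g j" "r * x"] by (simp add: mult.commute)
    show "(t * p j * g j = rate j * (if j \<le> l - 1 then put (mass g) j else call (mass g) j)) =
      (g j = 1 / (t * p j) * ((\<kappa> (j+1) - \<kappa> (j-1)) / ((\<kappa> (j+1) - \<kappa> j) * (\<kappa> j - \<kappa> (j-1)))) *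
           (if j \<le> l - 1 then (\<Sum>a=1..j-1. (\<kappa> j - \<kappa> a) * p a * (1 + t * g a * kt a))
            else (\<Sum>a=j+1..M. (\<kappa> a - \<kappa> j) * p a * (1 + t * g a * kt a))))"
      unfolding scale rate_def put_def call_def mass_def by (simp only: mult.assoc)
  qed
  then show ?thesis unfolding G_system_def G_system_at_def by blast
qed

lemma mass_pos:
  assumes "g \<in> nonneg_interior M" "j \<in> {1..M}"
  shows "0 < mass g j"
proof -
  have "0 \<le> g j" using assms(1) by (cases "j \<in> {2..M-1}") (auto simp: nonneg_interior_def)
  then have "0 \<le> t * g j * kt j" using t_pos kt_nonneg[of j] by simp
  then show ?thesis unfolding mass_def using p_pos[OF assms(2)] by simp
qed

lemma total_mass_pos: "g \<in> nonneg_interior M \<Longrightarrow> 0 < (\<Sum>a=1..M. mass g a)"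
  using M_ge mass_pos by (intro sum_pos) auto

lemma weighted_mean_eq:
  "weighted_mean M \<kappa> kt t p g = (\<Sum>a=1..M. \<kappa> a * mass g a) / (\<Sum>a=1..M. mass g a)"
  by (simp add: weighted_mean_def mass_def mult.assoc)

lemma less_weighted_mean_iff:
  assumes g: "g \<in> nonneg_interior M" and j: "j \<in> {1..M}"
  shows "\<kappa> j < weighted_mean M \<kappa> kt t p g \<longleftrightarrow> put (mass g) j < call (mass g) j"
proof -
  have "call (mass g) j - put (mass g) j
      = (\<Sum>a=1..M. \<kappa> a * mass g a) - \<kappa> j * (\<Sum>a=1..M. mass g a)"
    unfolding call_minus_put[OF j]
    by (simp add: left_diff_distrib sum_subtractf sum_distrib_left)
  then show ?thesis
    unfolding weighted_mean_eq pos_less_divide_eq[OF total_mass_pos[OF g]] by linarith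
qed

lemma mass_left:
  assumes g: "balance l g" and "l \<in> {2..M}" "a \<in> {1..l-1}"
  shows "mass g a = left_mass a"
  using assms(3)
proof (induction a rule: less_induct)
  case (less a)
  show ?case
  proof (cases "a \<in> {2..M-1}")
    case True
    have "put (mass g) a = put left_mass a" using less by (intro put_cong) auto
    then have "t * p a * g a = rate a * put left_mass a"
      using g True less.prems by (auto simp: balance_def)
    then show ?thesis by (subst left_mass_eq) (simp add: mass_def algebra_simps)
  next
    case False
    then show ?thesis by (subst left_mass_eq) (simp add: mass_def kt_outside)
  qed
qed

lemma mass_right:
  assumes g: "balance l g" and "l \<in> {2..M}" "a \<in> {l..M}"
  shows "mass g a = right_mass a"
  using assms(3)
proof (induction "M - a" arbitrary: a rule: less_induct)
  case less
  show ?case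
  proof (cases "a \<in> {2..M-1}")
    case True
    have "call (mass g) a = call right_mass a" using less by (intro call_cong) auto
    moreover have "\<not> a \<le> l - 1" using less.prems assms(2) by auto
    ultimately have "t * p a * g a = rate a * call right_mass a"
      using g True by (auto simp: balance_def)
    then show ?thesis by (subst right_mass_eq) (simp add: mass_def algebra_simps)
  next
    case False
    then show ?thesis by (subst right_mass_eq) (simp add: mass_def kt_outside)
  qed
qed

definition glued :: "nat \<Rightarrow> nat \<Rightarrow> real" where
  "glued l j = (if j \<in> {2..M-1}
     then rate j / (t * p j) * (if j \<le> l - 1 then put left_mass j else call right_mass j)
     else 0)"

lemma glued_nonneg_interior: "glued l \<in> nonneg_interior M"
proof -
  have "0 \<le> glued l j" if "j \<in> {2..M-1}" for j
  proof -
    have "0 \<le> put left_mass j" "0 \<le> call right_mass j"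
      using that left_mass_pos right_mass_pos
      by (auto intro!: put_nonneg call_nonneg simp: less_imp_le)
    then show ?thesis
      using that rate_pos[OF that] t_p_pos[OF that] by (auto simp: glued_def)
  qed
  then show ?thesis by (auto simp: nonneg_interior_def glued_def)
qed

lemma balance_glued:
  assumes l: "l \<in> {2..M}"
  shows "balance l (glued l)"
proof -
  have t_p_glued: "t * p j * glued l j
      = rate j * (if j \<le> l - 1 then put left_mass j else call right_mass j)"
    if "j \<in> {2..M-1}" for j
    using that t_p_pos[OF that] by (auto simp: glued_def)
  have m: "mass (glued l) j = (if j \<le> l - 1 then left_mass j else right_mass j)"
    if "j \<in> {1..M}" for j
  proof (cases "j \<in> {2..M-1}")
    case True
    have "mass (glued l) j = p j + kt j * (t * p j * glued l j)"
      by (simp add: mass_def algebra_simps)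
    then show ?thesis
      unfolding t_p_glued[OF True]
      using left_mass_eq[of j] right_mass_eq[of j] by (simp add: mult.assoc)
  next
    case False
    then show ?thesis
      using left_mass_eq[of j] right_mass_eq[of j] by (simp add: mass_def kt_outside)
  qed
  show ?thesis
    unfolding balance_def
  proof
    fix j assume j: "j \<in> {2..M-1}"
    have "put (mass (glued l)) j = put left_mass j" if "j \<le> l - 1"
      using m that j by (intro put_cong) auto
    moreover have "call (mass (glued l)) j = call right_mass j" if "\<not> j \<le> l - 1"
      using m that j by (intro call_cong) auto
    ultimately show "t * p j * glued l j = rate j *
        (if j \<le> l - 1 then put (mass (glued l)) j else call (mass (glued l)) j)"
      using t_p_glued[OF j] by auto
  qed
qed

lemma balance_imp_glued:
  assumes g: "g \<in> nonneg_interior M" and l: "l \<in> {2..M}" and bal: "balance l g"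
  shows "g = glued l"
proof
  fix j show "g j = glued l j"
  proof (cases "j \<in> {2..M-1}")
    case True
    have "put (mass g) j = put left_mass j" if "j \<le> l - 1"
      using mass_left[OF bal l] that by (intro put_cong) auto
    moreover have "call (mass g) j = call right_mass j" if "\<not> j \<le> l - 1"
      using mass_right[OF bal l] that by (intro call_cong) auto
    ultimately have "t * p j * g j
        = rate j * (if j \<le> l - 1 then put left_mass j else call right_mass j)"
      using bal True by (auto simp: balance_def)
    moreover have "t * p j \<noteq> 0" using t_p_pos[OF True] by linarith
    ultimately have "g j = rate j * (if j \<le> l - 1 then put left_mass j else call right_mass j)
        / (t * p j)"
      by (simp add: nonzero_eq_divide_eq mult.commute)
    then show ?thesis using True by (simp add: glued_def)
  next
    case False
    then show ?thesis using g by (auto simp: nonneg_interior_def glued_def)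
  qed
qed

lemma G_system_at_iff: "G_system_at l g \<longleftrightarrow> crossing l \<and> g = glued l"
proof -
  have "G_system_at l g \<longleftrightarrow> crossing l"
    if l: "l \<in> {2..M}" and g: "g \<in> nonneg_interior M" and bal: "balance l g" for l g
  proof -
    have "put (mass g) (l-1) = put left_mass (l-1)" "put (mass g) l = put left_mass l"
      using mass_left[OF bal l] by (auto intro!: put_cong)
    moreover have "call (mass g) (l-1) = call right_mass (l-1)" "call (mass g) l = call right_mass l"
      using mass_right[OF bal l] by (auto intro!: call_cong)
    moreover have "l \<in> {1..M}" "l - 1 \<in> {1..M}" using l by auto
    ultimately show ?thesis
      using that less_weighted_mean_iff[OF g]
      unfolding G_system_at_def crossing_def not_less[symmetric] by auto
  qed
  then show ?thesis
    using balance_imp_glued balance_glued glued_nonneg_interior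
    unfolding G_system_at_def crossing_def by metis
qed

lemma ex1_G_system: "\<exists>!g. G_system M \<kappa> kt t p g"
  unfolding G_system_iff G_system_at_iff using ex1_crossing by metis

text \<open>Testing a vector against \<open>1\<close> and against the functions \<open>x \<mapsto> max 0 (\<kappa> n - x)\<close>
  determines it.\<close>
lemma zero_iff_put_zero:
  "(\<forall>j\<in>{1..M}. D j = 0) \<longleftrightarrow> (\<forall>n\<in>{1..M}. put D n = 0) \<and> (\<Sum>a=1..M. D a) = 0"
proof safe
  assume "\<forall>j\<in>{1..M}. D j = 0"
  then show "(\<Sum>a=1..M. D a) = 0" "\<And>n. n \<in> {1..M} \<Longrightarrow> put D n = 0"
    by (auto simp: put_def intro!: sum.neutral)
next
  fix j assume P: "\<forall>n\<in>{1..M}. put D n = 0" and S: "(\<Sum>a=1..M. D a) = 0" and j: "j \<in> {1..M}"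
  have interior: "D j = 0" if "j \<in> {1..<M}" for j
    using that
  proof (induction j rule: less_induct)
    case (less j)
    have "put D (j+1) = (\<kappa> (j+1) - \<kappa> j) * D j + (\<Sum>a\<in>{1..j}-{j}. (\<kappa> (j+1) - \<kappa> a) * D a)"
      unfolding put_def using less.prems by (subst sum.remove[of _ j]) auto
    also have "(\<Sum>a\<in>{1..j}-{j}. (\<kappa> (j+1) - \<kappa> a) * D a) = 0"
      using less by (intro sum.neutral) auto
    finally have "(\<kappa> (j+1) - \<kappa> j) * D j = 0" using P less.prems by auto
    then show ?case using \<kappa>_less[of j "j+1"] less.prems by auto
  qed
  have "(\<Sum>a=1..M. D a) = D M + (\<Sum>a\<in>{1..M}-{M}. D a)"
    using M_ge by (subst sum.remove[of _ M]) auto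
  also have "(\<Sum>a\<in>{1..M}-{M}. D a) = 0" using interior by (intro sum.neutral) auto
  finally show "D j = 0" using S interior[of j] j by (cases "j = M") auto
qed

end

locale skeleton = increasing_grid +
  fixes i b k :: "nat \<Rightarrow> real"
  assumes sum_p: "(\<Sum>j=1..M. p j) = 1" and kt_eq: "kt = k_tilde M i k"
    and q_up_eq: "\<And>j. j \<in> {2..M-1} \<Longrightarrow> q_up i b j = (\<kappa> j - \<kappa> (j-1)) / (\<kappa> (j+1) - \<kappa> (j-1))"
    and q_down_eq: "\<And>j. j \<in> {2..M-1} \<Longrightarrow> q_down i b j = (\<kappa> (j+1) - \<kappa> j) / (\<kappa> (j+1) - \<kappa> (j-1))"
begin

definition potential :: "(nat \<Rightarrow> real) \<Rightarrow> nat \<Rightarrow> real" where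
  "potential lam j = t * p j * lam j / rate j"

definition slope :: "(nat \<Rightarrow> real) \<Rightarrow> nat \<Rightarrow> real" where
  "slope lam j = (potential lam j - potential lam (j+1)) / (\<kappa> (j+1) - \<kappa> j)"

lemma potential_outside:
  "lam \<in> nonneg_interior M \<Longrightarrow> j \<notin> {2..M-1} \<Longrightarrow> potential lam j = 0"
  by (simp add: potential_def nonneg_interior_def)

lemma
  assumes lam: "lam \<in> nonneg_interior M"
  shows flow_up: "t * p j * lam j * q_up i b j = potential lam j / (\<kappa> (j+1) - \<kappa> j)"
    and flow_down: "t * p j * lam j * q_down i b j = potential lam j / (\<kappa> j - \<kappa> (j-1))"
    and flow_total: "t * p j * lam j
      = potential lam j / (\<kappa> (j+1) - \<kappa> j) + potential lam j / (\<kappa> j - \<kappa> (j-1))"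
proof -
  define u v where "u = \<kappa> j - \<kappa> (j-1)" and "v = \<kappa> (j+1) - \<kappa> j"
  have uv: "\<kappa> (j+1) - \<kappa> (j-1) = u + v" by (simp add: u_def v_def)
  have pos: "0 < u" "0 < v" "0 < u + v" if "j \<in> {2..M-1}"
    using that \<kappa>_less[of "j-1" j] \<kappa>_less[of j "j+1"] \<kappa>_less[of "j-1" "j+1"]
    by (auto simp: u_def v_def)
  have zero: "lam j = 0" if "j \<notin> {2..M-1}" using lam that by (simp add: nonneg_interior_def)
  have pot: "potential lam j = t * p j * lam j * (v * u) / (u + v)"
    unfolding potential_def rate_def uv by (simp add: u_def v_def)
  show "t * p j * lam j * q_up i b j = potential lam j / (\<kappa> (j+1) - \<kappa> j)"
    using pos zero unfolding pot v_def[symmetric]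
    by (cases "j \<in> {2..M-1}") (simp_all add: q_up_eq uv[simplified] u_def[simplified, symmetric])
  show "t * p j * lam j * q_down i b j = potential lam j / (\<kappa> j - \<kappa> (j-1))"
    using pos zero unfolding pot u_def[symmetric]
    by (cases "j \<in> {2..M-1}") (simp_all add: q_down_eq uv[simplified] v_def[simplified, symmetric])
  show "t * p j * lam j
      = potential lam j / (\<kappa> (j+1) - \<kappa> j) + potential lam j / (\<kappa> j - \<kappa> (j-1))"
  proof (cases "j \<in> {2..M-1}")
    case True
    define x where "x = t * p j * lam j"
    have "x = x * (u + v) / (u + v)" using pos[OF True] by simp
    also have "\<dots> = x * (v * u) / (u + v) / v + x * (v * u) / (u + v) / u"
      using pos[OF True] by (simp add: distrib_left add_divide_distrib)
    finally show ?thesis unfolding pot v_def[symmetric] u_def[symmetric] x_def .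
  qed (simp add: pot zero)
qed

lemma row_times_N_tilde:
  assumes lam: "lam \<in> nonneg_interior M" and c: "c \<in> {1..M}"
  shows "row_times_matrix (M+1) (p_hat M p \<alpha>) (N_tilde M i b k t lam) c
    = \<alpha> * (mass lam c + slope lam c - slope lam (c-1))"
proof -
  have zero: "lam j = 0" if "j \<notin> {2..M-1}" for j using lam that by (simp add: nonneg_interior_def)
  have "N_tilde M i b k t lam r c
      = (if r = c then 1 + t * lam r * (1 + kt r) else 0)
        - (if r = c - 1 then t * lam r * q_up i b r else 0)
        - (if r = c + 1 then t * lam r * q_down i b r else 0)" if "r \<in> {1..M+1}" for r
    using that c zero[of r] unfolding N_tilde_def kt_eq by auto
  then have "row_times_matrix (M+1) (p_hat M p \<alpha>) (N_tilde M i b k t lam) c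
      = (\<Sum>r=1..M+1. (if r = c then p_hat M p \<alpha> r * (1 + t * lam r * (1 + kt r)) else 0)
        - (if r = c - 1 then p_hat M p \<alpha> r * (t * lam r * q_up i b r) else 0)
        - (if r = c + 1 then p_hat M p \<alpha> r * (t * lam r * q_down i b r) else 0))"
    unfolding row_times_matrix_def by (intro sum.cong) (simp_all add: right_diff_distrib)
  also have "\<dots> = \<alpha> * p c * (1 + t * lam c * (1 + kt c))
      - \<alpha> * p (c-1) * (t * lam (c-1) * q_up i b (c-1))
      - \<alpha> * p (c+1) * (t * lam (c+1) * q_down i b (c+1))"
    unfolding sum_subtractf sum.delta[OF finite_atLeastAtMost] using c zero[of 0] zero[of "M+1"]
    by (cases "c = 1"; cases "c = M") (auto simp: p_hat_def)
  also have "\<dots> = \<alpha> * (mass lam c + t * p c * lam c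
      - t * p (c-1) * lam (c-1) * q_up i b (c-1) - t * p (c+1) * lam (c+1) * q_down i b (c+1))"
    by (simp add: mass_def algebra_simps)
  also have "\<dots> = \<alpha> * (mass lam c + slope lam c - slope lam (c-1))"
    using c unfolding flow_up[OF lam] flow_down[OF lam] flow_total[OF lam, of c] slope_def
    by (simp add: diff_divide_distrib)
  finally show ?thesis .
qed

lemma row_times_N_tilde_last:
  assumes lam: "lam \<in> nonneg_interior M"
  shows "row_times_matrix (M+1) (p_hat M p \<alpha>) (N_tilde M i b k t lam) (M+1)
    = 1 - \<alpha> * (1 + t * (\<Sum>j=1..M. p j * lam j * kt j))"
proof -
  have zero: "lam j = 0" if "j \<notin> {2..M-1}" for j using lam that by (simp add: nonneg_interior_def)
  have "N_tilde M i b k t lam r (M+1) = - t * lam r * kt r" if "r \<in> {1..M}" for r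
    using that zero[of r] unfolding N_tilde_def kt_eq by auto
  then have "(\<Sum>r=1..M. p_hat M p \<alpha> r * N_tilde M i b k t lam r (M+1))
      = (\<Sum>r=1..M. - (\<alpha> * t) * (p r * lam r * kt r))"
    by (intro sum.cong) (auto simp: p_hat_def)
  also have "\<dots> = - (\<alpha> * t) * (\<Sum>r=1..M. p r * lam r * kt r)"
    by (rule sum_distrib_left[symmetric])
  finally have "(\<Sum>r=1..M. p_hat M p \<alpha> r * N_tilde M i b k t lam r (M+1))
      = - (\<alpha> * t) * (\<Sum>r=1..M. p r * lam r * kt r)" .
  moreover have "N_tilde M i b k t lam (M+1) (M+1) = 1"
    by (auto simp: N_tilde_def)
  ultimately show ?thesis
    unfolding row_times_matrix_def by (simp add: p_hat_def algebra_simps)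
qed

lemma total_mass: "(\<Sum>a=1..M. mass lam a) = 1 + t * (\<Sum>j=1..M. p j * lam j * kt j)"
proof -
  have "(\<Sum>a=1..M. mass lam a) = (\<Sum>a=1..M. p a) + (\<Sum>j=1..M. t * (p j * lam j * kt j))"
    unfolding mass_def sum.distrib[symmetric] by (intro sum.cong) (auto simp: algebra_simps)
  then show ?thesis unfolding sum_p sum_distrib_left[symmetric] .
qed

lemma sum_slope_diff:
  assumes lam: "lam \<in> nonneg_interior M"
  shows "(\<Sum>a=1..n. slope lam a - slope lam (a-1)) = slope lam n"
proof -
  have "slope lam 0 = 0" using potential_outside[OF lam] by (simp add: slope_def)
  then show ?thesis by (induction n) auto
qed

lemma put_slope_diff:
  assumes lam: "lam \<in> nonneg_interior M" and n: "n \<in> {1..M}"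
  shows "put (\<lambda>a. slope lam a - slope lam (a-1)) n = - potential lam n"
proof -
  have "n \<le> M \<longrightarrow> put (\<lambda>a. slope lam a - slope lam (a-1)) n = - potential lam n"
    if "1 \<le> n"
    using that
  proof (induction n rule: dec_induct)
    case base
    then show ?case using potential_outside[OF lam, of 1] by (simp add: put_def)
  next
    case (step n)
    let ?D = "\<lambda>a. slope lam a - slope lam (a-1)"
    have "put ?D (Suc n) = put ?D n + (\<Sum>a=1..n. (\<kappa> (Suc n) - \<kappa> n) * ?D a)"
      unfolding put_def'[of _ n] by (simp add: put_def sum.distrib[symmetric] algebra_simps)
    also have "(\<Sum>a=1..n. (\<kappa> (Suc n) - \<kappa> n) * ?D a) = (\<kappa> (Suc n) - \<kappa> n) * slope lam n"
      unfolding sum_distrib_left[symmetric] sum_slope_diff[OF lam] ..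
    finally show ?case
      using step \<kappa>_less[of n "Suc n"] by (auto simp: slope_def)
  qed
  then show ?thesis using n by auto
qed

definition target :: "nat \<Rightarrow> real \<Rightarrow> nat \<Rightarrow> real" where
  "target l x0 j = (if j = l then (x0 - \<kappa> (l-1)) / (\<kappa> l - \<kappa> (l-1))
     else if j = l - 1 then (\<kappa> l - x0) / (\<kappa> l - \<kappa> (l-1)) else 0)"

lemma sum_target:
  assumes l: "l \<in> {2..M}" and n: "l \<le> n"
  shows "(\<Sum>a=1..n. f a * target l x0 a)
    = f l * ((x0 - \<kappa> (l-1)) / (\<kappa> l - \<kappa> (l-1))) + f (l-1) * ((\<kappa> l - x0) / (\<kappa> l - \<kappa> (l-1)))"
proof -
  have "(\<Sum>a=1..n. f a * target l x0 a) = (\<Sum>a\<in>{l-1,l}. f a * target l x0 a)"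
    using l n by (intro sum.mono_neutral_right) (auto simp: target_def)
  also have "\<dots> = f l * ((x0 - \<kappa> (l-1)) / (\<kappa> l - \<kappa> (l-1)))
      + f (l-1) * ((\<kappa> l - x0) / (\<kappa> l - \<kappa> (l-1)))"
    using l by (auto simp: target_def)
  finally show ?thesis .
qed

lemma total_target:
  assumes l: "l \<in> {2..M}"
  shows "(\<Sum>a=1..M. target l x0 a) = 1"
proof -
  have "\<kappa> (l-1) < \<kappa> l" using l \<kappa>_less[of "l-1" l] by auto
  then show ?thesis
    using sum_target[OF l, of M "\<lambda>_. 1" x0] l by (simp add: add_divide_distrib[symmetric])
qed

lemma put_target:
  assumes l: "l \<in> {2..M}" and n: "n \<in> {1..M}"
  shows "put (target l x0) n = (if n \<le> l - 1 then 0 else \<kappa> n - x0)"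
proof (cases "n \<le> l - 1")
  case True
  then show ?thesis using n by (auto simp: put_def target_def intro!: sum.neutral)
next
  case False
  define u where "u = \<kappa> l - \<kappa> (l-1)"
  have u: "0 < u" using l \<kappa>_less[of "l-1" l] by (auto simp: u_def)
  have "put (target l x0) n = (\<Sum>a=1..n. (\<kappa> n - \<kappa> a) * target l x0 a)"
    by (rule put_def')
  also have "\<dots> = ((\<kappa> n - \<kappa> l) * (x0 - \<kappa> (l-1)) + (\<kappa> n - \<kappa> (l-1)) * (\<kappa> l - x0)) / u"
    using False by (subst sum_target[OF l]) (auto simp: u_def add_divide_distrib)
  also have "(\<kappa> n - \<kappa> l) * (x0 - \<kappa> (l-1)) + (\<kappa> n - \<kappa> (l-1)) * (\<kappa> l - x0) = (\<kappa> n - x0) * u"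
    by (simp add: u_def algebra_simps)
  finally show ?thesis using False u by simp
qed

lemma columns_iff:
  assumes lam: "lam \<in> nonneg_interior M" and l: "l \<in> {2..M}"
    and \<alpha>: "\<alpha> * (\<Sum>a=1..M. mass lam a) = 1"
  shows "(\<forall>c\<in>{1..M}. \<alpha> * (mass lam c + slope lam c - slope lam (c-1)) = target l x0 c)
    \<longleftrightarrow> balance l lam \<and> x0 = weighted_mean M \<kappa> kt t p lam"
proof -
  define S where "S = (\<Sum>a=1..M. mass lam a)"
  have S: "0 < S" using total_mass_pos[OF lam] by (simp add: S_def)
  have \<alpha>_eq: "\<alpha> = 1 / S" using \<alpha> nonzero_eq_divide_eq[of S \<alpha> 1] S unfolding S_def by auto
  define mean where "mean = weighted_mean M \<kappa> kt t p lam"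
  have mean: "(\<Sum>a=1..M. \<kappa> a * mass lam a) = mean * S"
    using S by (simp add: mean_def weighted_mean_eq S_def)
  have parity: "put (mass lam) n = call (mass lam) n + (\<kappa> n - mean) * S" if "n \<in> {1..M}" for n
    using call_minus_put[OF that, of "mass lam"] mean
    by (simp add: left_diff_distrib sum_subtractf sum_distrib_left[symmetric] S_def)
  let ?D = "\<lambda>c. \<alpha> * (mass lam c + slope lam c - slope lam (c-1)) - target l x0 c"
  have put_D: "put ?D n = \<alpha> * (put (mass lam) n - potential lam n) - put (target l x0) n"
    if "n \<in> {1..M}" for n
  proof -
    have "put ?D n = \<alpha> * (put (mass lam) n + put (\<lambda>a. slope lam a - slope lam (a-1)) n)
        - put (target l x0) n"
      unfolding put_def
      by (simp add: sum.distrib[symmetric] sum_subtractf[symmetric] sum_distrib_left algebra_simps)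
    then show ?thesis using put_slope_diff[OF lam that] by simp
  qed
  have "slope lam M = 0" using potential_outside[OF lam, of M] potential_outside[OF lam, of "M+1"] M_ge
    by (simp add: slope_def)
  then have "(\<Sum>c=1..M. mass lam c + slope lam c - slope lam (c-1)) = S"
    using sum_slope_diff[OF lam, of M]
    by (simp add: sum.distrib[symmetric] S_def add_diff_eq[symmetric] sum.distrib)
  then have "(\<Sum>c=1..M. ?D c) = 0"
    unfolding sum_subtractf sum_distrib_left[symmetric] total_target[OF l] using \<alpha>
    by (simp add: S_def sum_subtractf)
  then have "(\<forall>c\<in>{1..M}. ?D c = 0)
      \<longleftrightarrow> (\<forall>n\<in>{1..M}. \<alpha> * (put (mass lam) n - potential lam n) = put (target l x0) n)"
    using zero_iff_put_zero[of ?D] put_D by auto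
  also have "\<dots> \<longleftrightarrow> (\<forall>n\<in>{1..M}. potential lam n =
      put (mass lam) n - (if n \<le> l - 1 then 0 else (\<kappa> n - x0) * S))"
    using S by (intro ball_cong refl) (auto simp: put_target[OF l] \<alpha>_eq field_simps)
  also have "\<dots> \<longleftrightarrow> x0 = mean \<and> (\<forall>n\<in>{1..M}. potential lam n =
      (if n \<le> l - 1 then put (mass lam) n else call (mass lam) n))"
  proof -
    have "x0 = mean" if "\<forall>n\<in>{1..M}. potential lam n =
        put (mass lam) n - (if n \<le> l - 1 then 0 else (\<kappa> n - x0) * S)"
    proof -
      have "M \<in> {1..M}" "\<not> M \<le> l - 1" using l by auto
      then have "(\<kappa> M - x0) * S = put (mass lam) M"
        using that potential_outside[OF lam, of M] by force
      also have "\<dots> = (\<kappa> M - mean) * S" using parity[of M] M_ge by (simp add: call_def)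
      finally show ?thesis using S by simp
    qed
    moreover have "(\<forall>n\<in>{1..M}. potential lam n =
          put (mass lam) n - (if n \<le> l - 1 then 0 else (\<kappa> n - x0) * S)) \<longleftrightarrow>
        (\<forall>n\<in>{1..M}. potential lam n =
          (if n \<le> l - 1 then put (mass lam) n else call (mass lam) n))" if "x0 = mean"
      by (intro ball_cong refl) (simp add: parity that)
    ultimately show ?thesis by blast
  qed
  also have "\<dots> \<longleftrightarrow> x0 = mean \<and> balance l lam"
  proof -
    have "potential lam n = (if n \<le> l - 1 then put (mass lam) n else call (mass lam) n)
        \<longleftrightarrow> (n \<in> {2..M-1} \<longrightarrow> t * p n * lam n
          = rate n * (if n \<le> l - 1 then put (mass lam) n else call (mass lam) n))"
      if n: "n \<in> {1..M}" for n
    proof (cases "n \<in> {2..M-1}")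
      case True
      then show ?thesis using rate_pos[OF True] by (auto simp: potential_def field_simps)
    next
      case False
      then have "n = 1 \<or> n = M" using n by auto
      then show ?thesis
        using False potential_outside[OF lam False] l by (auto simp: put_def call_def)
    qed
    then show ?thesis unfolding balance_def by auto
  qed
  finally show ?thesis unfolding mean_def by auto
qed

lemma is_solution_iff:
  "is_solution M \<kappa> i b k t p \<alpha> l x0 lam \<longleftrightarrow>
    G_system_at l lam \<and> x0 = weighted_mean M \<kappa> kt t p lam \<and>
    \<alpha> = 1 / (1 + t * (\<Sum>j=1..M. p j * lam j * kt j))"
proof (cases "lam \<in> nonneg_interior M \<and> l \<in> {2..M}")
  case True
  then have lam: "lam \<in> nonneg_interior M" and l: "l \<in> {2..M}" by auto
  define S where "S = 1 + t * (\<Sum>j=1..M. p j * lam j * kt j)"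
  have "0 \<le> p j * lam j * kt j" if "j \<in> {1..M}" for j
    using lam p_pos[OF that] kt_nonneg[of j] kt_outside[of j]
    by (cases "j \<in> {2..M-1}") (auto simp: nonneg_interior_def)
  then have "0 \<le> (\<Sum>j=1..M. p j * lam j * kt j)" by (rule sum_nonneg)
  then have S: "1 \<le> S" using t_pos by (simp add: S_def)
  then have \<alpha>: "\<alpha> * S = 1 \<longleftrightarrow> \<alpha> = 1 / S" by (auto simp: field_simps)
  have \<alpha>_range: "0 < 1 / S" "1 / S \<le> 1" using S by auto
  have "{1..M+1} = insert (M+1) {1..M}" by auto
  then have "(\<forall>j\<in>{1..M+1}.
        row_times_matrix (M+1) (p_hat M p \<alpha>) (N_tilde M i b k t lam) j = target l x0 j) \<longleftrightarrow>
      \<alpha> * S = 1 \<and>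
      (\<forall>c\<in>{1..M}. \<alpha> * (mass lam c + slope lam c - slope lam (c-1)) = target l x0 c)"
    using l row_times_N_tilde[OF lam] row_times_N_tilde_last[OF lam]
    by (auto simp: target_def S_def)
  also have "\<dots> \<longleftrightarrow> \<alpha> = 1 / S \<and> balance l lam \<and> x0 = weighted_mean M \<kappa> kt t p lam"
    using columns_iff[OF lam l, of \<alpha> x0] \<alpha> unfolding total_mass S_def by blast
  finally show ?thesis
    unfolding is_solution_def G_system_at_def S_def[symmetric] target_def[symmetric]
    using lam l \<alpha>_range by metis
next
  case False
  then show ?thesis by (auto simp: is_solution_def G_system_at_def)
qed

lemma ex1_solution:
  "\<exists>!s. (\<lambda>(\<alpha>, l, x0, lam). is_solution M \<kappa> i b k t p \<alpha> l x0 lam) s"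
proof -
  obtain l where l: "crossing l" "\<And>l'. crossing l' \<Longrightarrow> l' = l" using ex1_crossing by blast
  show ?thesis
    unfolding is_solution_iff G_system_at_iff
    by (rule ex1I[of _ "(1 / (1 + t * (\<Sum>j=1..M. p j * glued l j * kt j)), l,
        weighted_mean M \<kappa> kt t p (glued l), glued l)"]) (use l(1) in \<open>auto dest: l(2)\<close>)
qed

lemma solution_formulas:
  assumes "is_solution M \<kappa> i b k t p \<alpha> l x0 lam"
  shows "lam = calG M \<kappa> kt t p" "\<alpha> = 1 / (1 + t * (\<Sum>j=1..M. p j * lam j * kt j))"
    "x0 = weighted_mean M \<kappa> kt t p (calG M \<kappa> kt t p)"
proof -
  have "G_system M \<kappa> kt t p lam" using assms by (auto simp: is_solution_iff G_system_iff)
  then show "lam = calG M \<kappa> kt t p"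
    unfolding calG_def using the1_equality[OF ex1_G_system] by metis
  then show "\<alpha> = 1 / (1 + t * (\<Sum>j=1..M. p j * lam j * kt j))"
    "x0 = weighted_mean M \<kappa> kt t p (calG M \<kappa> kt t p)"
    using assms by (auto simp: is_solution_iff)
qed

end

lemma Pi_coeff_step:
  assumes "2 \<le> j"
  shows "Pi_coeff i b j = Pi_coeff i b (j-1) * ((1 - gap i j * b j) / (1 + gap i (j+1) * b j))"
proof -
  have "{2..j} = insert j {2..j-1}" using assms by auto
  then show ?thesis using assms by (simp add: Pi_coeff_def)
qed

lemma e_minus_ge_1:
  assumes "p \<in> open_simplex M" "1 \<le> M" "\<theta> \<le> 1"
  shows "1 \<le> e_minus M p \<theta>"
proof -
  have "M \<in> {j\<in>{1..M}. \<theta> \<le> (\<Sum>n=1..j. p n)}" using assms by (auto simp: open_simplex_def)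
  then have "e_minus M p \<theta> \<in> {j\<in>{1..M}. \<theta> \<le> (\<Sum>n=1..j. p n)}"
    unfolding e_minus_def by (intro Inf_nat_def1) blast
  then show ?thesis by auto
qed

lemma e_plus_le:
  assumes "p \<in> open_simplex M" "1 \<le> M" "\<theta> \<le> 1"
  shows "e_plus M p \<theta> \<le> M"
proof -
  have "1 \<in> {j\<in>{1..M}. \<theta> \<le> (\<Sum>n=j..M. p n)}" using assms by (auto simp: open_simplex_def)
  then show ?thesis unfolding e_plus_def by (intro cSup_least) auto
qed

locale drifted_grid =
  fixes M :: nat and i b :: "nat \<Rightarrow> real"
  assumes i_less: "\<And>m n. 1 \<le> m \<Longrightarrow> m < n \<Longrightarrow> n \<le> M \<Longrightarrow> i m < i n"
    and b_bounds: "\<And>j. j \<in> {2..M-1} \<Longrightarrow>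
      - 1 / (i (j+1) - i j) < b j \<and> b j < 1 / (i j - i (j-1))"
begin

lemma gap_pos: "j \<in> {2..M} \<Longrightarrow> 0 < gap i j"
  using i_less[of "j-1" j] by (auto simp: gap_def)

lemma
  assumes j: "j \<in> {2..M-1}"
  shows down_factor_pos: "0 < 1 - gap i j * b j"
    and up_factor_pos: "0 < 1 + gap i (j+1) * b j"
proof -
  have "0 < gap i j" "0 < gap i (j+1)" using j gap_pos by auto
  moreover have "- 1 / gap i (j+1) < b j" "b j < 1 / gap i j"
    using b_bounds[OF j] by (auto simp: gap_def)
  ultimately show "0 < 1 - gap i j * b j" "0 < 1 + gap i (j+1) * b j"
    by (auto simp: field_simps)
qed

lemma Pi_coeff_pos: "j \<le> M - 1 \<Longrightarrow> 0 < Pi_coeff i b j"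
  unfolding Pi_coeff_def using down_factor_pos up_factor_pos
  by (intro prod_pos divide_pos_pos ballI) auto

lemma eps_pos:
  assumes "1 \<le> e_minus M p \<theta>" "e_minus M p \<theta> < e_plus M p \<theta>" "e_plus M p \<theta> \<le> M"
    and "j \<in> {2..M}"
  shows "0 < eps M i b p \<theta> j"
proof -
  have "0 < (\<Sum>a=e_minus M p \<theta>..<e_plus M p \<theta>. gap i (a+1) * Pi_coeff i b a)"
    using assms gap_pos Pi_coeff_pos by (intro sum_pos mult_pos_pos) auto
  then show ?thesis
    unfolding eps_def using assms gap_pos Pi_coeff_pos
    by (intro divide_pos_pos mult_pos_pos) auto
qed

lemma
  assumes pos: "0 < eps M i b p \<theta> j" "0 < eps M i b p \<theta> (j+1)" and j: "j \<in> {2..M-1}"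
  shows q_up_eps: "q_up i b j = eps M i b p \<theta> j / (eps M i b p \<theta> j + eps M i b p \<theta> (j+1))"
    and q_down_eps: "q_down i b j = eps M i b p \<theta> (j+1) / (eps M i b p \<theta> j + eps M i b p \<theta> (j+1))"
proof -
  define x y c where "x = gap i j" and "y = gap i (j+1)"
    and "c = max (i (e_plus M p \<theta>) - i (e_minus M p \<theta>)) 1 * Pi_coeff i b (j-1)
      / (\<Sum>a=e_minus M p \<theta>..<e_plus M p \<theta>. gap i (a+1) * Pi_coeff i b a)
      / (1 + y * b j)"
  have xy: "0 < x" "0 < y" "0 < 1 - x * b j" "0 < 1 + y * b j"
    using j gap_pos down_factor_pos up_factor_pos by (auto simp: x_def y_def)
  have ej: "eps M i b p \<theta> j = c * (x * (1 + y * b j))"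
    using xy by (simp add: eps_def c_def x_def)
  have ej1: "eps M i b p \<theta> (j+1) = c * (y * (1 - x * b j))"
    using j by (simp add: eps_def c_def Pi_coeff_step x_def y_def mult_ac)
  have c: "c \<noteq> 0" using pos ej by auto
  have total: "eps M i b p \<theta> j + eps M i b p \<theta> (j+1) = c * (x + y)"
    unfolding ej ej1 by (simp add: algebra_simps)
  have i: "i j - i (j-1) = x" "i (j+1) - i j = y" "i (j+1) - i (j-1) = x + y"
    by (auto simp: x_def y_def gap_def)
  show "q_up i b j = eps M i b p \<theta> j / (eps M i b p \<theta> j + eps M i b p \<theta> (j+1))"
    unfolding total unfolding ej q_up_def i using c by simp
  show "q_down i b j = eps M i b p \<theta> (j+1) / (eps M i b p \<theta> j + eps M i b p \<theta> (j+1))"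
    unfolding total unfolding ej1 q_down_def i using c by simp
qed

end

lemma kappa_less:
  assumes "\<And>j. j \<in> {2..M} \<Longrightarrow> 0 < eps M i b p \<theta> j" and "1 \<le> m" "m < n" "n \<le> M"
  shows "kappa M i b p \<theta> e m < kappa M i b p \<theta> e n"
proof -
  have kappa_Suc: "kappa M i b p \<theta> e j < kappa M i b p \<theta> e (Suc j)" if "1 \<le> j" "Suc j \<le> M" for j
    using kappa_step[of "Suc j" M i b p \<theta> e] assms(1)[of "Suc j"] that by auto
  have "Suc m \<le> n" using assms by auto
  then have "n \<le> M \<longrightarrow> kappa M i b p \<theta> e m < kappa M i b p \<theta> e n"
  proof (induction n rule: dec_induct)
    case base
    then show ?case using kappa_Suc assms by auto
  next
    case (step n)
    then show ?case using kappa_Suc[of n] assms(2) by auto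
  qed
  then show ?thesis using assms by auto
qed

theorem lemma7p4:
  fixes M e :: nat and i p b k \<kappa> kt :: "nat \<Rightarrow> real" and t \<theta> :: real
  assumes "3 \<le> M" and "0 < t"
    and "\<And>m n. 1 \<le> m \<Longrightarrow> m < n \<Longrightarrow> n \<le> M \<Longrightarrow> i m < i n"
    and "p \<in> open_simplex M"
    and "\<And>j. j \<in> {2..M-1} \<Longrightarrow> - 1 / (i (j+1) - i j) < b j \<and> b j < 1 / (i j - i (j-1))"
    and "\<And>j. j \<in> {2..M-1} \<Longrightarrow> 0 \<le> k j"
    and "0 < \<theta>" and "\<theta> < 1/2" and "e_minus M p \<theta> < e_plus M p \<theta>"
    and "e \<in> {1..M}" and "1/2 \<le> (\<Sum>j=1..e. p j)" and "1/2 \<le> (\<Sum>j=e..M. p j)"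
    and "\<kappa> = kappa M i b p \<theta> e" and "kt = k_tilde M i k"
  shows "(\<exists>!g. G_system M \<kappa> kt t p g) \<and>
    (\<exists>!s. (\<lambda>(\<alpha>, l, x0, lam). is_solution M \<kappa> i b k t p \<alpha> l x0 lam) s) \<and>
    (\<forall>\<alpha> l x0 lam. is_solution M \<kappa> i b k t p \<alpha> l x0 lam \<longrightarrow>
       (\<forall>j\<in>{2..M-1}. lam j = calG M \<kappa> kt t p j) \<and>
       \<alpha> = 1 / (1 + t * (\<Sum>j=1..M. p j * lam j * kt j)) \<and>
       x0 = (\<Sum>j=1..M. \<kappa> j * p j * (1 + t * calG M \<kappa> kt t p j * kt j)) /
            (\<Sum>j=1..M. p j * (1 + t * calG M \<kappa> kt t p j * kt j)))"
proof -
  interpret grid: drifted_grid M i b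
    using assms(3,5) by (rule drifted_grid.intro)
  have eps_pos: "0 < eps M i b p \<theta> j" if "j \<in> {2..M}" for j
    using that assms e_minus_ge_1[of p M \<theta>] e_plus_le[of p M \<theta>] by (intro grid.eps_pos) auto
  have kappa_diff: "\<kappa> j - \<kappa> (j-1) = eps M i b p \<theta> j" "\<kappa> (j+1) - \<kappa> j = eps M i b p \<theta> (j+1)"
    "\<kappa> (j+1) - \<kappa> (j-1) = eps M i b p \<theta> j + eps M i b p \<theta> (j+1)" if "2 \<le> j" for j
    using kappa_step[of j M i b p \<theta> e] kappa_step[of "j+1" M i b p \<theta> e] that
    by (auto simp: assms(13))
  interpret skeleton M \<kappa> kt p t i b k
  proof
    show "\<kappa> m < \<kappa> n" if "1 \<le> m" "m < n" "n \<le> M" for m n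
      unfolding assms(13) using eps_pos that by (rule kappa_less)
    show "0 \<le> kt j" for j
      using grid.gap_pos[of j] grid.gap_pos[of "j+1"] assms(6)[of j]
      unfolding assms(14) k_tilde_def gap_def
      by (auto intro!: mult_nonneg_nonneg simp: less_imp_le)
    show "kt j = 0" if "j \<notin> {2..M-1}" for j using that by (auto simp: assms(14) k_tilde_def)
    show "q_up i b j = (\<kappa> j - \<kappa> (j-1)) / (\<kappa> (j+1) - \<kappa> (j-1))" if "j \<in> {2..M-1}" for j
      using that eps_pos[of j] eps_pos[of "j+1"]
      by (subst grid.q_up_eps[where p = p and \<theta> = \<theta>]) (auto simp: kappa_diff[simplified])
    show "q_down i b j = (\<kappa> (j+1) - \<kappa> j) / (\<kappa> (j+1) - \<kappa> (j-1))" if "j \<in> {2..M-1}" for j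
      using that eps_pos[of j] eps_pos[of "j+1"]
      by (subst grid.q_down_eps[where p = p and \<theta> = \<theta>]) (auto simp: kappa_diff[simplified])
  qed (use assms in \<open>auto simp: open_simplex_def\<close>)
  show ?thesis
    using ex1_G_system ex1_solution solution_formulas by (auto simp: weighted_mean_def)
qed

end
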